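(* The isomorphism relation on countable tournaments is Borel reducible to the conjugacy relation on $\mathrm{Aut}(\mathcal{T})$. Hence the conjugacy relation on $\mathrm{Aut}(\mathcal{T})$ is Borel complete.
   Context: A tournament is an irreflexive binary relation $\to$ such that for any distinct $a,b$ exactly one of $a\to b$, $b\to a$ holds. $\mathcal{T}$ is the generic (random) countable tournament: the unique countable homogeneous tournament whose finite substructures are all finite tournaments. The isomorphism relation is on the standard Borel space of tournaments on $\mathbb{N}$; the conjugacy relation on $\mathrm{Aut}(\mathcal{T})$ identifies $\phi,\psi$ iff $\psi=\delta\phi\delta^{-1}$ for some $\delta\in\mathrm{Aut}(\mathcal{T})$. $E\leq_B F$ means there is a Borel $f$ with $x\mathrel{E}x'\iff f(x)\mathrel{F}f(x')$; $E$ is Borel complete if isomorphism on every Borel class of countable structures in a countable relational language is Borel reducible to $E$. *)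

theory Defs
  imports "HOL-Analysis.Analysis"
begin

section \<open>Tournaments\<close>

definition tournament_on :: "'a set \<Rightarrow> ('a \<Rightarrow> 'a \<Rightarrow> bool) \<Rightarrow> bool" where
  "tournament_on A R \<longleftrightarrow>
     (\<forall>a\<in>A. \<not> R a a) \<and> (\<forall>a\<in>A. \<forall>b\<in>A. a \<noteq> b \<longrightarrow> (R a b \<longleftrightarrow> \<not> R b a))"

text \<open>Isomorphism of two relations that both have the whole type as their universe.\<close>
definition rel_iso :: "('a \<Rightarrow> 'a \<Rightarrow> bool) \<Rightarrow> ('a \<Rightarrow> 'a \<Rightarrow> bool) \<Rightarrow> bool" where
  "rel_iso R S \<longleftrightarrow> (\<exists>f. bij f \<and> (\<forall>x y. R x y \<longleftrightarrow> S (f x) (f y)))"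

definition Aut :: "('a \<Rightarrow> 'a \<Rightarrow> bool) \<Rightarrow> ('a \<Rightarrow> 'a) set" where
  "Aut T = {\<phi>. bij \<phi> \<and> (\<forall>x y. T x y \<longleftrightarrow> T (\<phi> x) (\<phi> y))}"

definition conjugate_in_Aut ::
    "('a \<Rightarrow> 'a \<Rightarrow> bool) \<Rightarrow> ('a \<Rightarrow> 'a) \<Rightarrow> ('a \<Rightarrow> 'a) \<Rightarrow> bool" where
  "conjugate_in_Aut T \<phi> \<psi> \<longleftrightarrow> (\<exists>\<delta>\<in>Aut T. \<psi> = \<delta> \<circ> \<phi> \<circ> inv \<delta>)"

text \<open>Every isomorphism between finite substructures extends to an automorphism.\<close>
definition homogeneous :: "('a \<Rightarrow> 'a \<Rightarrow> bool) \<Rightarrow> bool" where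
  "homogeneous T \<longleftrightarrow>
     (\<forall>A g. finite A \<and> inj_on g A \<and> (\<forall>x\<in>A. \<forall>y\<in>A. T x y \<longleftrightarrow> T (g x) (g y))
        \<longrightarrow> (\<exists>\<phi>\<in>Aut T. \<forall>x\<in>A. \<phi> x = g x))"

text \<open>
  The generic countable tournament is determined up to isomorphism only; this predicate singles
  out its presentations with universe \<open>\<nat>\<close>. Substructures of a tournament are always
  tournaments, so the condition on finite substructures only has to say that every finite
  tournament embeds, and finite tournaments may be taken to live on sets of natural numbers.
\<close>
definition generic_tournament :: "(nat \<Rightarrow> nat \<Rightarrow> bool) \<Rightarrow> bool" where
  "generic_tournament T \<longleftrightarrow>
     tournament_on UNIV T \<and> homogeneous T \<and>
     (\<forall>(A :: nat set) R. finite A \<and> tournament_on A R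
        \<longrightarrow> (\<exists>e :: nat \<Rightarrow> nat. inj_on e A \<and> (\<forall>x\<in>A. \<forall>y\<in>A. R x y \<longleftrightarrow> T (e x) (e y))))"

section \<open>Borel spaces and Borel reducibility\<close>

text \<open>
  A Borel space is given as a measure of which only the space and the \<open>\<sigma>\<close>-algebra matter.
  Below, \<open>borel\<close> on a function type is generated by the product topology, with
  \<open>bool\<close> and \<open>nat\<close> discrete.
\<close>
definition tournament_space :: "(nat \<Rightarrow> nat \<Rightarrow> bool) measure" where
  "tournament_space = restrict_space borel {R. tournament_on UNIV R}"

definition Aut_space :: "(nat \<Rightarrow> nat \<Rightarrow> bool) \<Rightarrow> (nat \<Rightarrow> nat) measure" where
  "Aut_space T = restrict_space borel (Aut T)"

definition borel_reducible ::
    "'a measure \<Rightarrow> ('a \<Rightarrow> 'a \<Rightarrow> bool) \<Rightarrow> 'b measure \<Rightarrow> ('b \<Rightarrow> 'b \<Rightarrow> bool) \<Rightarrow> bool" where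
  "borel_reducible X E Y F \<longleftrightarrow>
     (\<exists>f \<in> measurable X Y. \<forall>x\<in>space X. \<forall>x'\<in>space X. E x x' \<longleftrightarrow> F (f x) (f x'))"

section \<open>Countable structures and Borel completeness\<close>

text \<open>
  A countable relational language is a set \<open>L\<close> of natural numbers (the relation symbols)
  together with an arity function \<open>ar\<close>. A structure with universe \<open>\<nat>\<close> sends a symbol
  \<open>i\<close> to a predicate on lists; it is required to be \<open>False\<close> outside \<open>L\<close> and on
  lists of length other than \<open>ar i\<close>, so structures are exactly the points of
  the product over \<open>i \<in> L\<close> of the spaces of \<open>ar i\<close>-ary relations on \<open>\<nat>\<close>.
\<close>
definition structures :: "nat set \<Rightarrow> (nat \<Rightarrow> nat) \<Rightarrow> (nat \<Rightarrow> nat list \<Rightarrow> bool) set" where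
  "structures L ar = {M. \<forall>i xs. M i xs \<longrightarrow> i \<in> L \<and> length xs = ar i}"

definition structure_space ::
    "nat set \<Rightarrow> (nat \<Rightarrow> nat) \<Rightarrow> (nat \<Rightarrow> nat list \<Rightarrow> bool) measure" where
  "structure_space L ar = restrict_space borel (structures L ar)"

definition structure_iso ::
    "(nat \<Rightarrow> nat list \<Rightarrow> bool) \<Rightarrow> (nat \<Rightarrow> nat list \<Rightarrow> bool) \<Rightarrow> bool" where
  "structure_iso M N \<longleftrightarrow> (\<exists>f. bij f \<and> (\<forall>i xs. M i xs \<longleftrightarrow> N i (map f xs)))"

text \<open>A Borel class is an isomorphism-invariant Borel set of structures.\<close>
definition borel_class ::
    "nat set \<Rightarrow> (nat \<Rightarrow> nat) \<Rightarrow> (nat \<Rightarrow> nat list \<Rightarrow> bool) set \<Rightarrow> bool" where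
  "borel_class L ar C \<longleftrightarrow>
     C \<in> sets (structure_space L ar) \<and>
     (\<forall>M\<in>C. \<forall>N\<in>structures L ar. structure_iso M N \<longrightarrow> N \<in> C)"

definition borel_complete :: "'a measure \<Rightarrow> ('a \<Rightarrow> 'a \<Rightarrow> bool) \<Rightarrow> bool" where
  "borel_complete X E \<longleftrightarrow>
     (\<forall>L ar C. borel_class L ar C \<longrightarrow>
        borel_reducible (restrict_space (structure_space L ar) C) structure_iso X E)"

end

theory Submission
  imports Defs
begin

text \<open>
  A countable structure \<open>M\<close> is encoded as the relation of being a fixed point of an
  automorphism \<open>\<phi>\<^sub>M\<close> of one fixed generic tournament.

  Over any tournament \<open>B\<close> there is a generic tournament consisting of \<open>B\<close> and of nested nodes,
  each carrying a finite list of earlier points (which it beats) and an integer label. It is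
  functorial in \<open>B\<close>: an automorphism of \<open>B\<close> extends to it, and it may shift all labels by
  \<open>1\<close> at the same time, so that its fixed points are exactly those in \<open>B\<close>.

  Applied to a point, with labels read as colours, the construction gives a generic tournament
  \<open>X\<close> coloured by \<open>\<nat>\<close>. By back and forth every permutation of the colours is induced by an
  automorphism of \<open>X\<close>. Take \<open>B\<close> to consist of tuples over \<open>X\<close> and of points coding relations
  on these, let \<open>M\<close> live on the colours, and let \<open>\<phi>\<^sub>M\<close> fix the point coding \<open>R(x)\<close> iff \<open>R\<close>
  holds in \<open>M\<close> of the colours of \<open>x\<close>. Isomorphisms of structures lift to automorphisms of \<open>X\<close> and
  hence conjugate the \<open>\<phi>\<^sub>M\<close>; conversely \<open>M\<close> can be read off from the tournament of fixed points.
  Tournaments are themselves structures, so this reduction gives both claims.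
\<close>

section \<open>Back and forth\<close>

text \<open>With a one-element colour type this is the usual extension axiom of the generic
  tournament. With more colours, every type over a finite set must be realised in each
  colour.\<close>

definition extension_property :: "('a \<Rightarrow> 'a \<Rightarrow> bool) \<Rightarrow> ('a \<Rightarrow> 'k) \<Rightarrow> bool" where
  "extension_property S d \<longleftrightarrow>
     (\<forall>U V k. finite U \<and> finite V \<and> U \<inter> V = {} \<longrightarrow>
        (\<exists>z. d z = k \<and> (\<forall>u\<in>U. S z u) \<and> (\<forall>v\<in>V. S v z)))"

definition partial_iso ::
    "('a \<Rightarrow> 'a \<Rightarrow> bool) \<Rightarrow> ('a \<Rightarrow> 'k) \<Rightarrow> ('b \<Rightarrow> 'b \<Rightarrow> bool) \<Rightarrow> ('b \<Rightarrow> 'k) \<Rightarrow> ('a \<times> 'b) set \<Rightarrow> bool" where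
  "partial_iso R c S d p \<longleftrightarrow> finite p \<and> (\<forall>x y. (x, y) \<in> p \<longrightarrow> c x = d y) \<and>
     (\<forall>x y x' y'. (x, y) \<in> p \<longrightarrow> (x', y') \<in> p \<longrightarrow> (x = x' \<longleftrightarrow> y = y') \<and> (R x x' \<longleftrightarrow> S y y'))"

lemma partial_iso_converse: "partial_iso R c S d p \<Longrightarrow> partial_iso S d R c (p\<inverse>)"
  unfolding partial_iso_def finite_converse converse_iff by metis

text \<open>The forth step. In the proof \<open>U\<close> and \<open>V\<close> carry the type of
  \<open>x\<close> over the domain of \<open>p\<close> to the range of \<open>p\<close>, and the
  extension property realises it in the colour of \<open>x\<close>.\<close>

lemma partial_iso_extend:
  assumes R: "tournament_on UNIV R" and S: "tournament_on UNIV S"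
    and ext: "extension_property S d" and p: "partial_iso R c S d p"
  shows "\<exists>y. partial_iso R c S d (insert (x, y) p)"
proof (cases "x \<in> Domain p")
  case True
  then show ?thesis using p by (metis Domain.cases insert_absorb)
next
  case False
  define U where "U = {b. \<exists>a. (a, b) \<in> p \<and> R x a}"
  define V where "V = {b. \<exists>a. (a, b) \<in> p \<and> R a x}"
  have fin: "finite p" using p by (simp add: partial_iso_def)
  have sub: "U \<subseteq> snd ` p" "V \<subseteq> snd ` p" by (force simp: U_def V_def)+
  have UV: "finite U" "finite V"
    by (rule finite_subset[OF sub(1)], simp add: fin) (rule finite_subset[OF sub(2)], simp add: fin)
  have pe: "a = a' \<longleftrightarrow> b = b'" "R a a' \<longleftrightarrow> S b b'" if "(a, b) \<in> p" "(a', b') \<in> p" for a b a' b'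
    using p that unfolding partial_iso_def by metis+
  have pc: "c a = d b" if "(a, b) \<in> p" for a b
    using p that unfolding partial_iso_def by blast
  have Rt: "\<not> R a a" "a \<noteq> b \<Longrightarrow> R a b \<longleftrightarrow> \<not> R b a" for a b
    using R unfolding tournament_on_def by blast+
  have St: "\<not> S a a" "a \<noteq> b \<Longrightarrow> S a b \<longleftrightarrow> \<not> S b a" for a b
    using S unfolding tournament_on_def by blast+
  have "U \<inter> V = {}"
  proof (rule equals0I)
    fix b assume "b \<in> U \<inter> V"
    then obtain a a' where a: "(a, b) \<in> p" "R x a" "(a', b) \<in> p" "R a' x"
      by (auto simp: U_def V_def)
    then have "a' = a" using pe(1)[of a b a' b] by simp
    then show False using a(2,4) Rt(1)[of x] Rt(2)[of x a] by auto
  qed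
  then obtain z where z: "d z = c x" "\<forall>u\<in>U. S z u" "\<forall>v\<in>V. S v z"
    using ext UV unfolding extension_property_def by metis
  have new: "x \<noteq> a \<and> z \<noteq> b \<and> (R x a \<longleftrightarrow> S z b) \<and> (R a x \<longleftrightarrow> S b z)" if "(a, b) \<in> p" for a b
  proof -
    have "x \<noteq> a" using False that by blast
    then have "R x a \<and> \<not> R a x \<and> b \<in> U \<or> R a x \<and> \<not> R x a \<and> b \<in> V"
      using that Rt(2)[of x a] unfolding U_def V_def by blast
    then show ?thesis
      using \<open>x \<noteq> a\<close> z St by metis
  qed
  have "partial_iso R c S d (insert (x, z) p)"
    unfolding partial_iso_def
  proof (intro conjI allI impI)
    show "finite (insert (x, z) p)" using fin by simp
  next
    fix a b assume "(a, b) \<in> insert (x, z) p"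
    then show "c a = d b" using pc z(1) by auto
  next
    fix a b a' b' assume ab: "(a, b) \<in> insert (x, z) p" "(a', b') \<in> insert (x, z) p"
    show "a = a' \<longleftrightarrow> b = b'"
      using ab pe(1)[of a b a' b'] new[of a b] new[of a' b'] by auto
    show "R a a' \<longleftrightarrow> S b b'"
      using ab pe(2)[of a b a' b'] new[of a b] new[of a' b'] Rt(1)[of x] St(1)[of z] by auto
  qed
  then show ?thesis by blast
qed

lemma back_and_forth:
  fixes R :: "'a::countable \<Rightarrow> 'a \<Rightarrow> bool" and S :: "'b::countable \<Rightarrow> 'b \<Rightarrow> bool"
  assumes R: "tournament_on UNIV R" "extension_property R c"
    and S: "tournament_on UNIV S" "extension_property S d"
  shows "\<exists>h. bij h \<and> (\<forall>x. d (h x) = c x) \<and> (\<forall>x y. R x y \<longleftrightarrow> S (h x) (h y))"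
proof -
  let ?good = "partial_iso R c S d"
  have step: "\<exists>q. ?good q \<and> p \<subseteq> q \<and> x \<in> Domain q \<and> y \<in> Range q" if "?good p" for p x y
  proof -
    obtain b where b: "?good (insert (x, b) p)"
      using partial_iso_extend[OF R(1) S \<open>?good p\<close>] by blast
    \<comment> \<open>The back step is the forth step for the converse relation.\<close>
    obtain a where "partial_iso S d R c (insert (y, a) ((insert (x, b) p)\<inverse>))"
      using partial_iso_extend[OF S(1) R partial_iso_converse[OF b]] by blast
    moreover have "(insert (y, a) ((insert (x, b) p)\<inverse>))\<inverse> = insert (a, y) (insert (x, b) p)"
      by auto
    ultimately have "?good (insert (a, y) (insert (x, b) p))"
      using partial_iso_converse by metis
    then show ?thesis by blast
  qed
  \<comment> \<open>Both types are enumerated by \<open>from_nat\<close>, so the union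
    \<open>G\<close> of this chain has full domain and full range.\<close>
  have "\<exists>f. \<forall>n. ?good (f n) \<and> (f n \<subseteq> f (Suc n) \<and> from_nat n \<in> Domain (f (Suc n)) \<and> from_nat n \<in> Range (f (Suc n)))"
  proof (rule dependent_nat_choice)
    show "\<exists>p. ?good p" by (rule exI[of _ "{}"]) (simp add: partial_iso_def)
  qed (use step in blast)
  then obtain p where p: "\<And>n. ?good (p n)" "\<And>n. p n \<subseteq> p (Suc n)"
      "\<And>n. from_nat n \<in> Domain (p (Suc n))" "\<And>n. from_nat n \<in> Range (p (Suc n))"
    by blast
  define G where "G = (\<Union>n. p n)"
  have mono: "p m \<subseteq> p n" if "m \<le> n" for m n
    using p(2) that by (rule lift_Suc_mono_le)
  have G: "c a = d b" "a = a' \<longleftrightarrow> b = b'" "R a a' \<longleftrightarrow> S b b'"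
    if ab: "(a, b) \<in> G" "(a', b') \<in> G" for a b a' b'
  proof -
    obtain m n where "(a, b) \<in> p m" "(a', b') \<in> p n" using ab by (auto simp: G_def)
    then have "(a, b) \<in> p (max m n)" "(a', b') \<in> p (max m n)"
      using mono[of m "max m n"] mono[of n "max m n"] by auto
    then show "c a = d b" "a = a' \<longleftrightarrow> b = b'" "R a a' \<longleftrightarrow> S b b'"
      using p(1)[of "max m n"] unfolding partial_iso_def by blast+
  qed
  have "\<exists>b. (a, b) \<in> G" for a
    using p(3)[of "to_nat a"] by (auto simp: G_def)
  then obtain h where h: "\<And>a. (a, h a) \<in> G" by metis
  have "\<exists>a. (a, b) \<in> G" for b
    using p(4)[of "to_nat b"] by (auto simp: G_def)
  then have "surj h" using G(2) h by (metis surjI)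
  moreover have "inj h" using G(2) h by (metis injI)
  moreover have "d (h x) = c x" "R x y \<longleftrightarrow> S (h x) (h y)" for x y
    using G(1,3) h by metis+
  ultimately show ?thesis unfolding bij_def by blast
qed

lemma generic_tournament_extension:
  assumes "generic_tournament T"
  shows "extension_property T (\<lambda>_. ())"
  unfolding extension_property_def
proof (intro allI impI)
  fix U V :: "nat set" and k :: unit
  assume UV: "finite U \<and> finite V \<and> U \<inter> V = {}"
  have T: "tournament_on UNIV T" "homogeneous T"
    using assms unfolding generic_tournament_def by blast+
  have emb: "\<And>R. finite A \<Longrightarrow> tournament_on A R \<Longrightarrow>
      \<exists>e. inj_on e A \<and> (\<forall>x\<in>A. \<forall>y\<in>A. R x y \<longleftrightarrow> T (e x) (e y))" for A :: "nat set"
    using assms unfolding generic_tournament_def by blast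
  have Tt: "\<not> T a a" "a \<noteq> b \<Longrightarrow> T a b \<longleftrightarrow> \<not> T b a" for a b
    using T(1) unfolding tournament_on_def by blast+
  obtain w where w: "w \<notin> U \<union> V"
    using UV by (meson ex_new_if_finite finite_UnI infinite_UNIV_nat)
  define R where "R x y = (if x = w then y \<in> U else if y = w then x \<in> V else T x y)" for x y
  have "tournament_on (insert w (U \<union> V)) R"
    unfolding tournament_on_def
  proof (intro conjI ballI impI)
    fix a assume "a \<in> insert w (U \<union> V)"
    then show "\<not> R a a" using w Tt(1) by (auto simp: R_def)
  next
    fix a b assume "a \<in> insert w (U \<union> V)" "b \<in> insert w (U \<union> V)" "a \<noteq> b"
    then show "R a b \<longleftrightarrow> \<not> R b a"
      using w Tt(2)[of a b] UV unfolding R_def by (smt (verit) UnE disjoint_iff insertE)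
  qed
  then obtain e where e: "inj_on e (insert w (U \<union> V))"
      "\<And>x y. x \<in> insert w (U \<union> V) \<Longrightarrow> y \<in> insert w (U \<union> V) \<Longrightarrow> R x y \<longleftrightarrow> T (e x) (e y)"
    using emb[of "insert w (U \<union> V)" R] UV by (metis finite_UnI finite_insert)
  define g where "g = the_inv_into (U \<union> V) e"
  have eUV: "inj_on e (U \<union> V)" using e(1) by (rule inj_on_subset) auto
  have g: "g (e x) = x" if "x \<in> U \<union> V" for x
    using the_inv_into_f_f[OF eUV that] by (simp add: g_def)
  have "finite (e ` (U \<union> V)) \<and> inj_on g (e ` (U \<union> V)) \<and>
     (\<forall>x\<in>e ` (U \<union> V). \<forall>y\<in>e ` (U \<union> V). T x y \<longleftrightarrow> T (g x) (g y))"
  proof (intro conjI ballI)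
    show "finite (e ` (U \<union> V))" using UV by simp
    show "inj_on g (e ` (U \<union> V))" unfolding g_def
      by (rule inj_on_the_inv_into[OF eUV])
  next
    fix x y assume "x \<in> e ` (U \<union> V)" "y \<in> e ` (U \<union> V)"
    then obtain a b where ab: "x = e a" "y = e b" "a \<in> U \<union> V" "b \<in> U \<union> V" by blast
    then have "a \<noteq> w" "b \<noteq> w" using w by auto
    then show "T x y \<longleftrightarrow> T (g x) (g y)"
      using e(2)[of a b] ab g by (simp add: R_def)
  qed
  then obtain \<phi> where \<phi>: "\<phi> \<in> Aut T" "\<forall>x\<in>e ` (U \<union> V). \<phi> x = g x"
    using T(2)[unfolded homogeneous_def, THEN spec, THEN spec, of "e ` (U \<union> V)" g] by blast
  have pres: "T (e x) (e y) \<longleftrightarrow> T (\<phi> (e x)) (\<phi> (e y))" for x y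
    using \<phi>(1) by (auto simp: Aut_def)
  have "T (\<phi> (e w)) u" if "u \<in> U" for u
    using e(2)[of w u] pres[of w u] \<phi>(2) g that by (auto simp: R_def)
  moreover have "T v (\<phi> (e w))" if "v \<in> V" for v
  proof -
    have "v \<noteq> w" using that w by auto
    then show ?thesis
      using e(2)[of v w] pres[of v w] \<phi>(2) g that by (auto simp: R_def)
  qed
  ultimately show "\<exists>z. () = k \<and> (\<forall>u\<in>U. T z u) \<and> (\<forall>v\<in>V. T v z)" by auto
qed

section \<open>Generic extensions of tournaments\<close>

fun lex_rel :: "('a \<Rightarrow> 'a \<Rightarrow> bool) \<Rightarrow> 'a list \<Rightarrow> 'a list \<Rightarrow> bool" where
  "lex_rel r xs [] \<longleftrightarrow> False"
| "lex_rel r [] (y # ys) \<longleftrightarrow> True"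
| "lex_rel r (x # xs) (y # ys) \<longleftrightarrow> r x y \<or> x = y \<and> lex_rel r xs ys"

text \<open>As a congruence rule it shows that the recursive calls of \<open>pt_arc\<close> hidden
  in \<open>lex_rel\<close> concern only members of the two lists, hence smaller arguments.\<close>

lemma lex_rel_cong [fundef_cong]:
  assumes "xs = xs'" "ys = ys'" "\<And>x y. x \<in> set xs' \<Longrightarrow> y \<in> set ys' \<Longrightarrow> r x y \<longleftrightarrow> r' x y"
  shows "lex_rel r xs ys \<longleftrightarrow> lex_rel r' xs' ys'"
proof -
  have "(\<And>x y. x \<in> set xs' \<Longrightarrow> y \<in> set ys' \<Longrightarrow> r x y \<longleftrightarrow> r' x y) \<Longrightarrow> lex_rel r xs' ys' \<longleftrightarrow> lex_rel r' xs' ys'"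
    by (induction r xs' ys' rule: lex_rel.induct) auto
  with assms show ?thesis by auto
qed

text \<open>
  In \<open>pt_arc\<close> below a node beats its members and other pairs of nodes are compared by label,
  ties being broken lexicographically. Keeping the members in a list rather than a set is
  what makes this tie-break available, and invariant under automorphisms of the base.
\<close>
datatype 'b pt = Base 'b | Node "'b pt list" int

instance pt :: (countable) countable
  by countable_datatype

fun pt_arc :: "('b \<Rightarrow> 'b \<Rightarrow> bool) \<Rightarrow> 'b pt \<Rightarrow> 'b pt \<Rightarrow> bool" where
  "pt_arc r (Base a) (Base b) \<longleftrightarrow> r a b"
| "pt_arc r (Base a) (Node l n) \<longleftrightarrow> Base a \<notin> set l"
| "pt_arc r (Node l n) (Base b) \<longleftrightarrow> Base b \<in> set l"
| "pt_arc r (Node l n) (Node l' n') \<longleftrightarrow>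
     Node l' n' \<in> set l \<or>
     Node l n \<notin> set l' \<and> (n < n' \<or> n = n' \<and> lex_rel (pt_arc r) l l')"

section \<open>Extending automorphisms of the base\<close>

fun lift :: "('b \<Rightarrow> 'b) \<Rightarrow> int \<Rightarrow> 'b pt \<Rightarrow> 'b pt" where
  "lift g k (Base b) = Base (g b)"
| "lift g k (Node l n) = Node (map (lift g k) l) (n + k)"

lemma lift_comp: "lift g k (lift h m x) = lift (g \<circ> h) (k + m) x"
  by (induction h m x rule: lift.induct) auto

lemma lift_id: "lift id 0 x = x"
  by (induction "id :: 'a \<Rightarrow> 'a" "0::int" x rule: lift.induct) (auto intro: map_idI)

lemma bij_lift:
  assumes "bij g"
  shows "bij (lift g k)"
proof (rule o_bij)
  show "lift (inv g) (- k) \<circ> lift g k = id" "lift g k \<circ> lift (inv g) (- k) = id"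
    using assms by (auto simp: fun_eq_iff lift_comp lift_id bij_is_inj bij_is_surj surj_iff[THEN iffD1])
qed

lemma lex_rel_map:
  assumes "inj g" "\<And>x y. x \<in> set xs \<Longrightarrow> y \<in> set ys \<Longrightarrow> r (g x) (g y) \<longleftrightarrow> r x y"
  shows "lex_rel r (map g xs) (map g ys) \<longleftrightarrow> lex_rel r xs ys"
  using assms(2)
  by (induction r xs ys rule: lex_rel.induct) (auto simp: inj_eq[OF assms(1)])

text \<open>Membership survives because \<open>lift g k\<close> is injective, label comparison
  because all labels move by the same \<open>k\<close>, and the tie-break by induction on the
  members.\<close>

lemma arc_lift:
  assumes "bij g" "\<And>x y. r (g x) (g y) \<longleftrightarrow> r x y"
  shows "pt_arc r (lift g k x) (lift g k y) \<longleftrightarrow> pt_arc r x y"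
proof -
  note inj = bij_is_inj[OF bij_lift[OF assms(1)]]
  have im: "lift g k z \<in> lift g k ` set l \<longleftrightarrow> z \<in> set l" for l z
    using inj by (simp add: inj_image_mem_iff)
  show ?thesis
    using assms(2)
  proof (induction r x y rule: pt_arc.induct)
    case (4 r l n l' n')
    have "lex_rel (pt_arc r) (map (lift g k) l) (map (lift g k) l') \<longleftrightarrow> lex_rel (pt_arc r) l l'"
      using 4 by (intro lex_rel_map inj) auto
    then show ?case
      using im[of "Node l' n'" l] im[of "Node l n" l'] by auto
  qed (use im[of "Base _"] in auto)
qed

text \<open>The hypothesis concerns only entries of the two lists because that is what the induction
  in \<open>arc_tournament\<close> supplies.\<close>

lemma lex_rel_tournament:
  assumes "\<And>x y. x \<in> set xs \<Longrightarrow> y \<in> set ys \<Longrightarrow> (x = y \<longrightarrow> \<not> r x y) \<and> (x \<noteq> y \<longrightarrow> (r x y \<longleftrightarrow> \<not> r y x))"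
  shows "(xs = ys \<longrightarrow> \<not> lex_rel r xs ys) \<and> (xs \<noteq> ys \<longrightarrow> (lex_rel r xs ys \<longleftrightarrow> \<not> lex_rel r ys xs))"
  using assms
proof (induction r xs ys rule: lex_rel.induct)
  case (1 r xs)
  then show ?case by (cases xs) auto
next
  case (3 r x xs y ys)
  have "(x = y \<longrightarrow> \<not> r x y) \<and> (x \<noteq> y \<longrightarrow> (r x y \<longleftrightarrow> \<not> r y x))"
    using "3.prems"[of x y] by auto
  moreover have "(xs = ys \<longrightarrow> \<not> lex_rel r xs ys) \<and> (xs \<noteq> ys \<longrightarrow> (lex_rel r xs ys \<longleftrightarrow> \<not> lex_rel r ys xs))"
    if "x = y"
    using that "3.prems" by (intro "3.IH") auto
  ultimately show ?case by auto
qed auto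

lemma size_member: "x \<in> set l \<Longrightarrow> size x < size (Node l n)"
  by (simp add: less_Suc_eq_le size_list_estimation')

lemma arc_tournament:
  assumes "tournament_on UNIV r"
  shows "tournament_on UNIV (pt_arc r)"
proof -
  have "(x = y \<longrightarrow> \<not> pt_arc r x y) \<and> (x \<noteq> y \<longrightarrow> (pt_arc r x y \<longleftrightarrow> \<not> pt_arc r y x))" for x y
    using assms
  proof (induction r x y rule: pt_arc.induct)
    case (4 r l n l' n')
    \<comment> \<open>By size, two nodes are never members of each other, so the membership clauses
      cannot conflict.\<close>
    have "Node l' n' \<notin> set l \<or> Node l n \<notin> set l'"
      by (meson size_member order_less_asym)
    moreover have "Node l n \<notin> set l" for l :: "'a pt list" and n
      by (meson size_member order_less_irrefl)
    moreover have "(l = l' \<longrightarrow> \<not> lex_rel (pt_arc r) l l') \<and> (l \<noteq> l' \<longrightarrow> (lex_rel (pt_arc r) l l' \<longleftrightarrow> \<not> lex_rel (pt_arc r) l' l))"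
      using 4 by (intro lex_rel_tournament) blast
    moreover have "n < n' \<longleftrightarrow> \<not> n' < n \<and> n \<noteq> n'"
      by linarith
    ultimately show ?case
      unfolding pt_arc.simps pt.inject by (smt (verit))
  next
    case (1 r a b)
    then show ?case
      unfolding tournament_on_def pt_arc.simps pt.inject by blast
  qed simp_all
  then show ?thesis
    unfolding tournament_on_def by blast
qed

text \<open>The witness has member set \<open>U\<close>; a label above all labels of elements of \<open>V\<close>
  and of their members lets every element of \<open>V\<close> beat it.\<close>
lemma arc_extension:
  assumes "finite U" "finite V" "U \<inter> V = {}"
  shows "\<exists>N. \<forall>n\<ge>N. \<exists>l. (\<forall>u\<in>U. pt_arc r (Node l n) u) \<and> (\<forall>v\<in>V. pt_arc r v (Node l n))"
proof -
  obtain l where l: "set l = U" using assms(1) finite_list by blast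
  define lab :: "'a pt \<Rightarrow> int" where "lab x = (case x of Base _ \<Rightarrow> 0 | Node _ n \<Rightarrow> n)" for x
  define kids :: "'a pt \<Rightarrow> 'a pt set" where "kids x = (case x of Base _ \<Rightarrow> {} | Node l _ \<Rightarrow> set l)" for x
  have "finite (V \<union> \<Union> (kids ` V))" using assms(2) by (auto simp: kids_def split: pt.splits)
  then have "finite (lab ` (V \<union> \<Union> (kids ` V)))" by (rule finite_imageI)
  then obtain m where m: "\<And>x. x \<in> V \<union> \<Union> (kids ` V) \<Longrightarrow> lab x \<le> m"
    by (meson Max_ge imageI)
  have "pt_arc r v (Node l n)" if "v \<in> V" "n \<ge> m + 1" for v n
  proof (cases v)
    case (Base b)
    then show ?thesis using that assms(3) l by auto
  next
    case (Node l' n')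
    have "n' < n" using m[of v] that Node by (simp add: lab_def)
    moreover have "Node l n \<notin> set l'"
    proof
      assume "Node l n \<in> set l'"
      then have "lab (Node l n) \<le> m"
        using that(1) Node by (intro m UnI2 UN_I[of v]) (auto simp: kids_def)
      then show False using that(2) by (simp add: lab_def)
    qed
    moreover have "v \<notin> set l" using that assms(3) l by auto
    ultimately show ?thesis using Node by simp
  qed
  moreover have "pt_arc r (Node l n) u" if "u \<in> U" for u n
    using that l by (cases u) auto
  ultimately show ?thesis by blast
qed

section \<open>Coding relations by fixed points\<close>

text \<open>
  \<open>Rel i xs z\<close> (\<open>z\<close> an integer) will be fixed or moved to \<open>Rel i xs (z + 1)\<close> according
  to whether the \<open>i\<close>-th relation holds of \<open>xs\<close>; all other base points stay fixed. Arcs go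
  from lower to higher \<open>level\<close>, except that \<open>attached\<close> pairs are reversed. The points
  \<open>Count\<close> and \<open>Label\<close> make the level, and hence the relation \<open>attached\<close>, definable in the
  tournament of fixed points.
\<close>
datatype 'x base = Count nat | Label nat | Elem 'x | Tup "'x list" | Rel nat "'x list" int

instance base :: (countable) countable
  by countable_datatype

text \<open>Odd levels from \<open>3\<close> on belong to tuples, even ones from \<open>4\<close> on
  to relation points, where the code records symbol and arity. Level, \<open>entries\<close> and
  \<open>idx\<close> together determine a point.\<close>

fun level :: "'x base \<Rightarrow> nat" where
  "level (Count _) = 0"
| "level (Label _) = 1"
| "level (Elem _) = 2"
| "level (Tup xs) = 3 + 2 * length xs"
| "level (Rel i xs _) = 4 + 2 * prod_encode (i, length xs)"

fun entries :: "'x base \<Rightarrow> 'x list" where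
  "entries (Count _) = []"
| "entries (Label _) = []"
| "entries (Elem x) = [x]"
| "entries (Tup xs) = xs"
| "entries (Rel _ xs _) = xs"

fun idx :: "'x base \<Rightarrow> int" where
  "idx (Count j) = int j"
| "idx (Label j) = int j"
| "idx (Elem _) = 0"
| "idx (Tup _) = 0"
| "idx (Rel _ _ z) = z"

text \<open>A tuple is tied to its last entry and to the tuple without that entry, so that its
  entries can be recovered in order by recursion; a relation point reaches its arguments through one
  tuple.\<close>

fun attached :: "'x base \<Rightarrow> 'x base \<Rightarrow> bool" where
  "attached (Label j) (Count i) \<longleftrightarrow> i = j"
| "attached (Elem x) (Label j) \<longleftrightarrow> j = level (Elem x)"
| "attached (Tup xs) (Label j) \<longleftrightarrow> j = level (Tup xs)"
| "attached (Rel i xs z) (Label j) \<longleftrightarrow> j = level (Rel i xs z)"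
| "attached (Tup xs) (Elem x) \<longleftrightarrow> xs \<noteq> [] \<and> x = last xs"
| "attached (Tup xs) (Tup ys) \<longleftrightarrow> xs \<noteq> [] \<and> ys = butlast xs"
| "attached (Rel i xs z) (Tup ys) \<longleftrightarrow> ys = xs"
| "attached _ _ \<longleftrightarrow> False"

definition base_arc :: "('x \<Rightarrow> 'x \<Rightarrow> bool) \<Rightarrow> 'x base \<Rightarrow> 'x base \<Rightarrow> bool" where
  "base_arc r a b \<longleftrightarrow> attached a b \<or> \<not> attached b a \<and>
     (level a < level b \<or> level a = level b \<and>
       (lex_rel r (entries a) (entries b) \<or> entries a = entries b \<and> idx a < idx b))"

text \<open>For a relation point over its tuple this uses that the code of a pair is at least its
  second component, here the length. In particular attachment is asymmetric.\<close>

lemma attached_level: "attached a b \<Longrightarrow> level b < level a"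
  using le_prod_encode_2
  by (induction a b rule: attached.induct) (auto simp: less_Suc_eq_le)

lemma base_eqI:
  assumes "level a = level b" "entries a = entries b" "idx a = idx b"
  shows "a = b"
proof -
  have "3 + 2 * m \<noteq> 4 + 2 * n" "3 + 2 * m \<noteq> (2::nat)" "4 + 2 * n \<noteq> 3 + 2 * m" "(2::nat) \<noteq> 3 + 2 * m" for m n :: nat
    by presburger+
  then show ?thesis using assms
    by (cases a; cases b) (auto simp: prod_encode_eq)
qed

lemma base_arc_tournament:
  assumes "tournament_on UNIV r"
  shows "tournament_on UNIV (base_arc r)"
proof -
  have irr: "\<not> base_arc r a a" for a
    using attached_level[of a a] lex_rel_tournament[of "entries a" "entries a" r] assms
    unfolding base_arc_def tournament_on_def by blast
  have "base_arc r a b \<longleftrightarrow> \<not> base_arc r b a" if "a \<noteq> b" for a b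
  proof -
    have lex: "(entries a = entries b \<longrightarrow> \<not> lex_rel r (entries a) (entries b)) \<and>
      (entries a \<noteq> entries b \<longrightarrow> (lex_rel r (entries a) (entries b) \<longleftrightarrow> \<not> lex_rel r (entries b) (entries a)))"
      using assms unfolding tournament_on_def by (intro lex_rel_tournament) blast
    have ne: "level a \<noteq> level b \<or> entries a \<noteq> entries b \<or> idx a \<noteq> idx b"
      using base_eqI that by blast
    have "\<not> (attached a b \<and> attached b a)"
      using attached_level[of a b] attached_level[of b a] by auto
    then show ?thesis
      using lex ne unfolding base_arc_def by (smt (verit) linorder_neqE_nat order_less_asym)
  qed
  with irr show ?thesis unfolding tournament_on_def by blast
qed

lemma base_arc_map:
  assumes g: "inj g" "\<And>x y. r (g x) (g y) \<longleftrightarrow> r x y"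
  shows "base_arc r (map_base g a) (map_base g b) \<longleftrightarrow> base_arc r a b"
proof -
  have [simp]: "level (map_base g a) = level a" "entries (map_base g a) = map g (entries a)"
    "idx (map_base g a) = idx a" for a
    by (cases a; simp)+
  have [simp]: "map g xs = map g ys \<longleftrightarrow> xs = ys" for xs ys
    by (simp add: inj_map_eq_map[OF g(1)])
  have [simp]: "attached (map_base g a) (map_base g b) \<longleftrightarrow> attached a b" for a b
    by (induction a b rule: attached.induct)
      (auto simp: last_map inj_eq[OF g(1)] simp flip: map_butlast)
  show ?thesis
    unfolding base_arc_def using lex_rel_map[OF g(1), of _ _ r] g(2) by simp
qed

lemma bij_map_base: "bij g \<Longrightarrow> bij (map_base g)"
  by (rule o_bij[of "map_base (inv g)"])
    (auto simp: fun_eq_iff base.map_comp base.map_id bij_is_inj bij_is_surj surj_iff[THEN iffD1]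
      simp flip: id_def)

section \<open>Automorphisms moving relation points, and what their fixed points determine\<close>

fun shift :: "(nat \<Rightarrow> 'x list \<Rightarrow> bool) \<Rightarrow> 'x base \<Rightarrow> 'x base" where
  "shift H (Rel i xs z) = Rel i xs (if H i xs then z else z + 1)"
| "shift H b = b"

lemma shift_fixed_iff: "shift H b = b \<longleftrightarrow> (\<forall>i xs z. b = Rel i xs z \<longrightarrow> H i xs)"
  by (cases b) auto

lemma bij_shift: "bij (shift H)"
proof (rule o_bij)
  let ?s = "\<lambda>b. case b of Rel i xs z \<Rightarrow> Rel i xs (if H i xs then z else z - 1) | _ \<Rightarrow> b"
  show "?s \<circ> shift H = id" "shift H \<circ> ?s = id"
    by (auto simp: fun_eq_iff split: base.splits elim!: shift.elims)
qed

text \<open>Attachment, level and entries do not depend on the integer of a relation point. Indices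
  are compared only when level and entries agree; two relation points then share symbol and
  arguments and move by the same amount.\<close>

lemma base_arc_shift: "base_arc r (shift H a) (shift H b) \<longleftrightarrow> base_arc r a b"
proof -
  have [simp]: "level (shift H a) = level a" "entries (shift H a) = entries a" for a
    by (cases a; simp)+
  have [simp]: "attached (shift H a) (shift H b) \<longleftrightarrow> attached a b" for a b
    by (induction a b rule: attached.induct) auto
  have "idx (shift H a) < idx (shift H b) \<longleftrightarrow> idx a < idx b"
    if "level a = level b" "entries a = entries b"
  proof -
    have "3 + 2 * m \<noteq> 4 + 2 * n" "4 + 2 * n \<noteq> 3 + 2 * m" for m n :: nat by presburger+
    then show ?thesis using that by (cases a; cases b) (auto simp: prod_encode_eq)
  qed
  then show ?thesis unfolding base_arc_def by auto
qed

text \<open>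
  \<open>Count j\<close> is the only fixed point of in-degree \<open>j + 1\<close>: it is beaten by the earlier
  \<open>Count\<close> points and by \<open>Label j\<close>, and every other point is beaten by infinitely many
  \<open>Count\<close> points. Then \<open>Label j\<close> is the remaining point beating \<open>Count j\<close>, and among the other
  points those of level \<open>j\<close> are the ones that beat \<open>Label j\<close>.
\<close>
lemma relations_iso_of_fixed_points_iso:
  assumes h: "bij_betw h {b. shift H b = b} {b. shift H' b = b}"
    and arc: "\<And>a b. shift H a = a \<Longrightarrow> shift H b = b \<Longrightarrow> base_arc r (h a) (h b) \<longleftrightarrow> base_arc r a b"
  shows "\<exists>g. bij g \<and> (\<forall>i xs. H i xs \<longleftrightarrow> H' i (map g xs))"
proof -
  define F where "F = {b. shift H b = b}"
  define F' where "F' = {b. shift H' b = b}"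
  have hF: "h ` F = F'" and inj: "inj_on h F"
    using h by (auto simp: bij_betw_def F_def F'_def)
  have arcF: "base_arc r (h a) (h b) \<longleftrightarrow> base_arc r a b" if "a \<in> F" "b \<in> F" for a b
    using arc that by (simp add: F_def)
  have F [simp]: "Count j \<in> F" "Label j \<in> F" "Elem x \<in> F" "Tup xs \<in> F"
    "Rel i xs z \<in> F \<longleftrightarrow> H i xs" for j x xs i z
    by (auto simp: F_def)
  have F' [simp]: "Count j \<in> F'" "Label j \<in> F'" "Elem x \<in> F'" "Tup xs \<in> F'"
    "Rel i xs z \<in> F' \<longleftrightarrow> H' i xs" for j x xs i z
    by (auto simp: F'_def)
  have count_nbrs: "{b \<in> A. base_arc r b (Count j)} = Count ` {..<j} \<union> {Label j}"
    if "\<And>i. Count i \<in> A" "\<And>i. Label i \<in> A" for A :: "'a base set" and j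
  proof -
    have "base_arc r b (Count j) \<longleftrightarrow> b \<in> Count ` {..<j} \<union> {Label j}" for b
      by (cases b) (auto simp: base_arc_def)
    then show ?thesis using that by auto
  qed
  have inf_nbrs: "infinite {b \<in> F'. base_arc r b c}" if c: "\<And>i. c \<noteq> Count i" for c
  proof -
    \<comment> \<open>At most one \<open>Count\<close> point fails to beat \<open>c\<close>: it
      exists only if \<open>c\<close> is a \<open>Label\<close> point, and is then the one to which
      \<open>c\<close> is attached.\<close>
    obtain j where "\<And>i. i \<noteq> j \<Longrightarrow> base_arc r (Count i) c"
      using c by (cases c) (auto simp: base_arc_def)
    then have "Count ` (UNIV - {j}) \<subseteq> {b \<in> F'. base_arc r b c}" by auto
    moreover have "infinite (Count ` (UNIV - {j}) :: 'a base set)"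
      by (subst finite_image_iff) (auto simp: inj_on_def)
    ultimately show ?thesis by (meson finite_subset)
  qed
  have h_count [simp]: "h (Count j) = Count j" for j
  proof -
    have card: "finite {b \<in> A. base_arc r b (Count j)} \<and> card {b \<in> A. base_arc r b (Count j)} = Suc j"
      if "\<And>i. Count i \<in> A" "\<And>i. Label i \<in> A" for A :: "'a base set" and j
      unfolding count_nbrs[OF that] by (subst card_Un_disjoint) (auto simp: card_image inj_on_def)
    have img: "{b \<in> F'. base_arc r b (h (Count j))} = h ` {b \<in> F. base_arc r b (Count j)}"
      using arcF hF by (force simp flip: hF)
    have "finite {b \<in> F'. base_arc r b (h (Count j))}" 
      unfolding img using card[of F j] by simp
    then obtain i where i: "h (Count j) = Count i" using inf_nbrs by blast
    have "card {b \<in> F'. base_arc r b (h (Count j))} = card {b \<in> F. base_arc r b (Count j)}"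
      unfolding img by (rule card_image) (rule inj_on_subset[OF inj], auto)
    then show ?thesis using card[of F' i] card[of F j] i by simp
  qed
  have h_label [simp]: "h (Label j) = Label j" for j
  proof -
    have "base_arc r (h (Label j)) (Count j)"
      using arcF[of "Label j" "Count j"] by (simp add: base_arc_def)
    moreover have "h (Label j) \<noteq> Count i" for i
      using inj_onD[OF inj, of "Label j" "Count i"] by auto
    ultimately show ?thesis
      using count_nbrs[of UNIV j] by blast
  qed
  have label_level: "base_arc r b (Label j) \<longleftrightarrow> level b = j" if "level b \<ge> 2" for b :: "'a base" and j
    using that by (cases b) (auto simp: base_arc_def)
  have h_level: "level (h b) = level b" if "b \<in> F" "level b \<ge> 2" for b
  proof -
    have "h b \<noteq> Count j" "h b \<noteq> Label j" for j
      using inj_onD[OF inj, of b "Count j"] inj_onD[OF inj, of b "Label j"] that by auto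
    then have "level (h b) \<ge> 2" by (cases "h b") auto
    then show ?thesis
      using arcF[of b "Label (level b)"] label_level[of b] label_level[of "h b"] that by simp
  qed
  have par: "3 + 2 * m \<noteq> 4 + 2 * n" for m n :: nat by presburger
  have h_elem: "\<exists>y. h (Elem x) = Elem y" for x
    using h_level[of "Elem x"] by (cases "h (Elem x)") auto
  then obtain g where g: "\<And>x. h (Elem x) = Elem (g x)" by metis
  have "inj g"
    using inj_onD[OF inj, of "Elem _" "Elem _"] g by (intro injI) simp
  moreover have "surj g"
  proof -
    have "\<exists>x. y = g x" for y
    proof -
      have "Elem y \<in> h ` F" unfolding hF by simp
      then obtain b where b: "b \<in> F" "h b = Elem y" by auto
      have "level b \<ge> 2" using b by (cases b) auto
      then have "level b = 2" using h_level[of b] b by simp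
      then obtain x where "b = Elem x" by (cases b) auto
      then show ?thesis using b g by auto
    qed
    then show ?thesis by blast
  qed
  ultimately have "bij g" by (simp add: bij_def)
  \<comment> \<open>As \<open>h\<close> keeps levels from \<open>2\<close> on, the direction of an
    arc between different such levels tells whether its ends are attached.\<close>
  have attF: "attached (h a) (h b) \<longleftrightarrow> attached a b"
    if "a \<in> F" "b \<in> F" "level b < level a" "level b \<ge> 2" for a b
    using arcF[of a b] h_level[of a] h_level[of b] that attached_level[of b a] attached_level[of "h b" "h a"]
    by (auto simp: base_arc_def)
  have h_tup: "h (Tup xs) = Tup (map g xs)" for xs
  proof (induction xs rule: rev_induct)
    case Nil
    show ?case using h_level[of "Tup []"] by (cases "h (Tup [])") auto
  next
    case (snoc x xs)
    obtain ys where ys: "h (Tup (xs @ [x])) = Tup ys"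
      using h_level[of "Tup (xs @ [x])"] par by (cases "h (Tup (xs @ [x]))") auto
    \<comment> \<open>These two attachments give the last entry of \<open>ys\<close> and, by the
      induction hypothesis, the rest.\<close>
    have "attached (Tup ys) (Elem (g x))" "attached (Tup ys) (Tup (map g xs))"
      using attF[of "Tup (xs @ [x])" "Elem x"] attF[of "Tup (xs @ [x])" "Tup xs"] ys g snoc by auto
    then show ?case using ys by (auto simp: snoc_eq_iff_butlast)
  qed
  \<comment> \<open>The level yields the symbol and the arity, the attached tuple yields the
    arguments; the integer may change.\<close>
  have h_rel: "\<exists>z'. h (Rel i xs z) = Rel i (map g xs) z'" if H: "H i xs" for i xs z
  proof -
    obtain i' ys z' where y: "h (Rel i xs z) = Rel i' ys z'"
      "prod_encode (i', length ys) = prod_encode (i, length xs)"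
      using h_level[of "Rel i xs z"] H par[of _ "prod_encode (i, length xs)"]
      by (cases "h (Rel i xs z)") auto
    have "level (Tup xs) < level (Rel i xs z)"
      using attached_level[of "Rel i xs z" "Tup xs"] by simp
    then have "attached (Rel i' ys z') (Tup (map g xs))"
      using attF[of "Rel i xs z" "Tup xs"] y h_tup H by simp
    then show ?thesis using y by (auto simp: prod_encode_eq)
  qed
  have "H i xs \<longleftrightarrow> H' i (map g xs)" for i xs
  proof
    assume "H i xs"
    moreover from this have "h (Rel i xs 0) \<in> F'" using hF by auto
    ultimately show "H' i (map g xs)" using h_rel[of i xs 0] by auto
  next
    assume "H' i (map g xs)"
    then have "Rel i (map g xs) 0 \<in> h ` F" unfolding hF by simp
    then obtain b where b: "b \<in> F" "h b = Rel i (map g xs) 0" by auto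
    have "level b \<ge> 2" using b by (cases b) auto
    then have "level b = 4 + 2 * prod_encode (i, length xs)" using h_level[of b] b by simp
    then obtain i' ys z where y: "b = Rel i' ys z" using par by (cases b) auto
    then have "H i' ys" using b by simp
    then show "H i xs" using h_rel[of i' ys z] y b inj_map_eq_map[OF \<open>inj g\<close>] by auto
  qed
  with \<open>bij g\<close> show ?thesis by blast
qed

section \<open>The reduction\<close>

lemma conjugate_iff_commutes:
  assumes "\<phi> \<in> Aut T" "\<psi> \<in> Aut T"
  shows "conjugate_in_Aut T \<phi> \<psi> \<longleftrightarrow> (\<exists>\<delta>\<in>Aut T. \<delta> \<circ> \<phi> = \<psi> \<circ> \<delta>)"
proof -
  have "\<psi> = \<delta> \<circ> \<phi> \<circ> inv \<delta> \<longleftrightarrow> \<delta> \<circ> \<phi> = \<psi> \<circ> \<delta>" if "\<delta> \<in> Aut T" for \<delta>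
  proof -
    have b: "bij \<delta>" using that by (simp add: Aut_def)
    then have i: "inv \<delta> \<circ> \<delta> = id" "\<delta> \<circ> inv \<delta> = id"
      by (simp_all add: bij_is_inj bij_is_surj surj_iff[THEN iffD1])
    show ?thesis
    proof
      assume "\<psi> = \<delta> \<circ> \<phi> \<circ> inv \<delta>"
      then show "\<delta> \<circ> \<phi> = \<psi> \<circ> \<delta>" by (simp add: comp_assoc i)
    next
      assume "\<delta> \<circ> \<phi> = \<psi> \<circ> \<delta>"
      then show "\<psi> = \<delta> \<circ> \<phi> \<circ> inv \<delta>" by (simp add: comp_assoc i)
    qed
  qed
  then show ?thesis unfolding conjugate_in_Aut_def by blast
qed

lemma Aut_transport:
  assumes G: "bij G" "\<And>x y. S x y \<longleftrightarrow> T (G x) (G y)" and "\<phi> \<in> Aut S"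
  shows "G \<circ> \<phi> \<circ> inv G \<in> Aut T"
proof -
  have [simp]: "G (inv G y) = y" for y
    using G(1) by (simp add: bij_is_surj surj_f_inv_f)
  have "T x y \<longleftrightarrow> T (G (\<phi> (inv G x))) (G (\<phi> (inv G y)))" for x y
    using assms(3) G(2)[of "inv G x" "inv G y"] G(2)[of "\<phi> (inv G x)" "\<phi> (inv G y)"]
    by (simp add: Aut_def)
  then show ?thesis
    using assms by (simp add: Aut_def bij_comp bij_imp_bij_inv)
qed

section \<open>The coloured tournament over one point, and the generic host tournament\<close>

definition const_arc :: "unit \<Rightarrow> unit \<Rightarrow> bool" where
  "const_arc x y \<longleftrightarrow> False"

definition elem_arc :: "unit pt \<Rightarrow> unit pt \<Rightarrow> bool" where
  "elem_arc = pt_arc const_arc"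

text \<open>Decoding a pair makes each colour recur at arbitrarily large labels, which is needed
  because \<open>arc_extension\<close> gives witnesses only for large labels. The base point gets
  the default colour \<open>0\<close>, and negative labels are read as \<open>0\<close>.\<close>

definition colour :: "unit pt \<Rightarrow> nat" where
  "colour x = (case x of Base _ \<Rightarrow> 0 | Node _ n \<Rightarrow> fst (prod_decode (nat n)))"

definition host :: "unit pt base pt \<Rightarrow> unit pt base pt \<Rightarrow> bool" where
  "host = pt_arc (base_arc elem_arc)"

lemma elem_arc_tournament: "tournament_on UNIV elem_arc"
  unfolding elem_arc_def
  by (rule arc_tournament) (simp add: tournament_on_def const_arc_def)

lemma elem_arc_extension: "extension_property elem_arc colour"
  unfolding extension_property_def elem_arc_def
proof (intro allI impI)
  fix U V :: "unit pt set" and k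
  assume "finite U \<and> finite V \<and> U \<inter> V = {}"
  then obtain N where N: "\<And>n. N \<le> n \<Longrightarrow>
      \<exists>l. (\<forall>u\<in>U. pt_arc const_arc (Node l n) u) \<and> (\<forall>v\<in>V. pt_arc const_arc v (Node l n))"
    using arc_extension[of U V const_arc] by blast
  \<comment> \<open>This code is a label of colour \<open>k\<close>, and its second component pushes
    it to at least \<open>N\<close>.\<close>
  have "N \<le> int (prod_encode (k, nat N))"
    using le_prod_encode_2[of "nat N" k] by linarith
  from N[OF this] obtain l where "(\<forall>u\<in>U. pt_arc const_arc (Node l (int (prod_encode (k, nat N)))) u) \<and>
      (\<forall>v\<in>V. pt_arc const_arc v (Node l (int (prod_encode (k, nat N)))))"
    by blast
  moreover have "colour (Node l (int (prod_encode (k, nat N)))) = k"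
    by (simp add: colour_def)
  ultimately show "\<exists>z. colour z = k \<and> (\<forall>u\<in>U. pt_arc const_arc z u) \<and> (\<forall>v\<in>V. pt_arc const_arc v z)"
    by blast
qed

lemma host_tournament: "tournament_on UNIV host"
  unfolding host_def
  by (intro arc_tournament base_arc_tournament elem_arc_tournament)

lemma host_extension: "extension_property host (\<lambda>_. ())"
  unfolding extension_property_def host_def
proof (intro allI impI)
  fix U V :: "unit pt base pt set" and k :: unit
  assume "finite U \<and> finite V \<and> U \<inter> V = {}"
  then show "\<exists>z. () = k \<and> (\<forall>u\<in>U. pt_arc (base_arc elem_arc) z u) \<and>
      (\<forall>v\<in>V. pt_arc (base_arc elem_arc) v z)"
    using arc_extension[of U V "base_arc elem_arc"] by (metis old.unit.exhaust order_refl)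
qed

lemma surj_colour: "surj colour"
proof -
  have "\<exists>z. colour z = k" for k
    using elem_arc_extension unfolding extension_property_def
    by (metis Int_empty_left finite.emptyI)
  then show ?thesis by (metis surjI)
qed

text \<open>Equality becomes relation \<open>0\<close>, so that an isomorphism of pullbacks respects the
  fibres of \<open>colour\<close> and descends to an isomorphism of structures.\<close>
definition with_equality :: "(nat \<Rightarrow> nat list \<Rightarrow> bool) \<Rightarrow> nat \<Rightarrow> nat list \<Rightarrow> bool" where
  "with_equality M i ys = (case i of 0 \<Rightarrow> \<exists>y. ys = [y, y] | Suc j \<Rightarrow> M j ys)"

definition pullback :: "(nat \<Rightarrow> nat list \<Rightarrow> bool) \<Rightarrow> nat \<Rightarrow> unit pt list \<Rightarrow> bool" where
  "pullback M i xs = with_equality M i (map colour xs)"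

section \<open>Isomorphism of structures and conjugacy of their coding automorphisms\<close>

definition coding_aut :: "(nat \<Rightarrow> nat list \<Rightarrow> bool) \<Rightarrow> unit pt base pt \<Rightarrow> unit pt base pt" where
  "coding_aut M = lift (shift (pullback M)) 1"

lemma coding_aut_in_Aut: "coding_aut M \<in> Aut host"
  unfolding Aut_def coding_aut_def host_def
  by (simp add: bij_lift bij_shift arc_lift base_arc_shift)

text \<open>Recolouring by the bijection \<open>f\<close> keeps the extension property, so back and
  forth gives an automorphism \<open>\<alpha>\<close> of \<open>elem_arc\<close> inducing
  \<open>f\<close> on colours. It carries one pullback to the other, and its lift with label shift
  \<open>0\<close> commutes as required.\<close>

lemma structure_iso_imp_commutes:
  assumes "structure_iso M N"
  shows "\<exists>\<delta>\<in>Aut host. \<delta> \<circ> coding_aut M = coding_aut N \<circ> \<delta>"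
proof -
  obtain f where f: "bij f" "\<And>i xs. M i xs \<longleftrightarrow> N i (map f xs)"
    using assms unfolding structure_iso_def by blast
  have "extension_property elem_arc (f \<circ> colour)"
    unfolding extension_property_def
  proof (intro allI impI)
    fix U V :: "unit pt set" and k assume "finite U \<and> finite V \<and> U \<inter> V = {}"
    then obtain z where "colour z = inv f k" "\<forall>u\<in>U. elem_arc z u" "\<forall>v\<in>V. elem_arc v z"
      using elem_arc_extension unfolding extension_property_def by meson
    moreover have "f (inv f k) = k"
      using f(1) by (simp add: bij_is_surj surj_f_inv_f)
    ultimately show "\<exists>z. (f \<circ> colour) z = k \<and> (\<forall>u\<in>U. elem_arc z u) \<and> (\<forall>v\<in>V. elem_arc v z)"
      by (intro exI[of _ z]) simp
  qed
  then obtain \<alpha> where \<alpha>: "bij \<alpha>" "\<And>x. colour (\<alpha> x) = f (colour x)"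
      "\<And>x y. elem_arc x y \<longleftrightarrow> elem_arc (\<alpha> x) (\<alpha> y)"
    using back_and_forth[OF elem_arc_tournament _ elem_arc_tournament elem_arc_extension, of "f \<circ> colour"]
    by auto
  have we: "with_equality M i ys \<longleftrightarrow> with_equality N i (map f ys)" for i ys
    using f(2) inj_eq[OF bij_is_inj[OF f(1)]]
    by (auto simp: with_equality_def map_eq_Cons_conv split: nat.split)
  have pb: "pullback M i xs \<longleftrightarrow> pullback N i (map \<alpha> xs)" for i xs
    unfolding pullback_def we by (simp add: \<alpha>(2) comp_def)
  have "map_base \<alpha> \<circ> shift (pullback M) = shift (pullback N) \<circ> map_base \<alpha>"
  proof
    fix b show "(map_base \<alpha> \<circ> shift (pullback M)) b = (shift (pullback N) \<circ> map_base \<alpha>) b"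
      by (cases b) (simp_all add: pb)
  qed
  then have "lift (map_base \<alpha>) 0 \<circ> coding_aut M = coding_aut N \<circ> lift (map_base \<alpha>) 0"
    by (intro ext) (simp add: coding_aut_def lift_comp)
  moreover have "lift (map_base \<alpha>) 0 \<in> Aut host"
    unfolding Aut_def host_def
    using \<alpha>(3) by (simp add: bij_lift bij_map_base \<alpha>(1) arc_lift base_arc_map bij_is_inj)
  ultimately show ?thesis by blast
qed

lemma structure_iso_of_pullback_iso:
  assumes g: "bij g" "\<And>i xs. pullback M i xs \<longleftrightarrow> pullback N i (map g xs)"
  shows "structure_iso M N"
proof -
  define s where "s = inv colour"
  have s: "colour (s n) = n" for n
    by (simp add: s_def surj_f_inv_f surj_colour)
  have eq: "colour x = colour y \<longleftrightarrow> colour (g x) = colour (g y)" for x y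
    using g(2)[of 0 "[x, y]"] by (auto simp: pullback_def with_equality_def)
  \<comment> \<open>Since \<open>g\<close> respects the fibres of \<open>colour\<close> by
    \<open>eq\<close>, the section \<open>s\<close> only picks representatives.\<close>
  define f where "f n = colour (g (s n))" for n
  have f: "colour (g x) = f (colour x)" for x
    unfolding f_def using eq[of x "s (colour x)"] s by simp
  have "inj f"
    by (rule injI) (metis eq f_def s)
  moreover have "surj f"
  proof (rule surjI)
    fix n
    have "g (inv g (s n)) = s n" using g(1) by (simp add: bij_is_surj surj_f_inv_f)
    then show "f (colour (inv g (s n))) = n" using f[of "inv g (s n)"] s by simp
  qed
  moreover have "M i ys \<longleftrightarrow> N i (map f ys)" for i ys
    using g(2)[of "Suc i" "map s ys"] by (simp add: pullback_def with_equality_def comp_def f s)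
  ultimately show ?thesis unfolding structure_iso_def bij_def by blast
qed

text \<open>A commuting \<open>\<delta>\<close> maps the fixed points of one coding automorphism
  onto those of the other. These are base points, so \<open>\<delta>\<close> restricts to an
  isomorphism of the tournaments of fixed points of the two shifts.\<close>

lemma commutes_imp_structure_iso:
  assumes \<delta>: "\<delta> \<in> Aut host" "\<delta> \<circ> coding_aut M = coding_aut N \<circ> \<delta>"
  shows "structure_iso M N"
proof -
  \<comment> \<open>Every label grows by \<open>1\<close>, so no node is fixed.\<close>
  have fixed: "coding_aut M p = p \<longleftrightarrow> (\<exists>b. p = Base b \<and> shift (pullback M) b = b)" for M p
    by (cases p) (auto simp: coding_aut_def)
  have bij: "bij \<delta>" and arc: "host x y \<longleftrightarrow> host (\<delta> x) (\<delta> y)" for x y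
    using \<delta>(1) by (auto simp: Aut_def)
  have fixed_iff: "coding_aut N (\<delta> p) = \<delta> p \<longleftrightarrow> coding_aut M p = p" for p
    using fun_cong[OF \<delta>(2), of p] inj_eq[OF bij_is_inj[OF bij], of "coding_aut M p" p] by simp
  define h where "h b = (THE c. \<delta> (Base b) = Base c)" for b
  have h: "\<delta> (Base b) = Base (h b)" "shift (pullback N) (h b) = h b" if "shift (pullback M) b = b" for b
  proof -
    have "coding_aut M (Base b) = Base b"
      using that by (simp add: fixed)
    then have "coding_aut N (\<delta> (Base b)) = \<delta> (Base b)"
      by (simp only: fixed_iff)
    then obtain c where "\<delta> (Base b) = Base c" "shift (pullback N) c = c"
      using fixed by blast
    then show "\<delta> (Base b) = Base (h b)" "shift (pullback N) (h b) = h b"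
      by (simp_all add: h_def)
  qed
  have "bij_betw h {b. shift (pullback M) b = b} {b. shift (pullback N) b = b}"
    unfolding bij_betw_def
  proof (rule conjI)
    show "inj_on h {b. shift (pullback M) b = b}"
    proof (rule inj_onI)
      fix a b assume ab: "a \<in> {b. shift (pullback M) b = b}" "b \<in> {b. shift (pullback M) b = b}" "h a = h b"
      then have "\<delta> (Base a) = \<delta> (Base b)" using h(1)[of a] h(1)[of b] by simp
      then show "a = b" using inj_eq[OF bij_is_inj[OF bij]] by simp
    qed
    have "c \<in> h ` {b. shift (pullback M) b = b}" if c: "shift (pullback N) c = c" for c
    proof -
      obtain p where p: "\<delta> p = Base c" using bij by (metis bij_pointE)
      have "coding_aut N (Base c) = Base c" using c by (simp add: fixed)
      then have "coding_aut M p = p" using fixed_iff[of p] unfolding p by blast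
      then obtain b where b: "p = Base b" "shift (pullback M) b = b" using fixed by blast
      then have "c = h b" using h(1)[OF b(2)] p by simp
      then show ?thesis using b(2) by blast
    qed
    then show "h ` {b. shift (pullback M) b = b} = {b. shift (pullback N) b = b}"
      using h(2) by blast
  qed
  moreover have "base_arc elem_arc (h a) (h b) \<longleftrightarrow> base_arc elem_arc a b"
    if "shift (pullback M) a = a" "shift (pullback M) b = b" for a b
    using arc[of "Base a" "Base b"]
    unfolding h(1)[OF that(1)] h(1)[OF that(2)] host_def pt_arc.simps by blast
  ultimately obtain g where "bij g" "\<forall>i xs. pullback M i xs \<longleftrightarrow> pullback N i (map g xs)"
    using relations_iso_of_fixed_points_iso[of h "pullback M" "pullback N" elem_arc] by blast
  then show ?thesis by (intro structure_iso_of_pullback_iso) auto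
qed

section \<open>Borel measurability of the coding\<close>

lemma measurable_coordinate:
  "(\<lambda>M :: nat \<Rightarrow> nat list \<Rightarrow> bool. M i xs) \<in> measurable borel (count_space UNIV)"
proof -
  have "continuous_on UNIV (\<lambda>M :: nat \<Rightarrow> nat list \<Rightarrow> bool. M i xs)"
    by (rule continuous_on_product_then_coordinatewise[OF
          continuous_on_product_then_coordinatewise[OF continuous_on_id]])
  then have "(\<lambda>M :: nat \<Rightarrow> nat list \<Rightarrow> bool. M i xs) \<in> borel_measurable borel"
    by (rule borel_measurable_continuous_onI)
  from measurable_sets[OF this borel_open[OF open_discrete]] show ?thesis
    by (subst measurable_count_space_eq2_countable) auto
qed

lemma measurable_pullback:
  "(\<lambda>M. pullback M i xs) \<in> measurable borel (count_space UNIV)"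
  by (cases i) (simp_all add: pullback_def with_equality_def measurable_coordinate)

text \<open>For fixed \<open>p\<close> the value depends on finitely many coordinates of
  \<open>M\<close>, at most one for each relation point occurring in \<open>p\<close>.\<close>

lemma measurable_coding_aut:
  "(\<lambda>M. coding_aut M p) \<in> measurable borel (count_space UNIV)"
proof (induction p)
  case (Base b)
  have "(\<lambda>M. Base (shift (pullback M) b)) \<in> measurable borel (count_space UNIV)"
  proof (cases b)
    case (Rel i xs z)
    have "(\<lambda>M. if pullback M i xs then Base (Rel i xs z) else Base (Rel i xs (z + 1)))
        \<in> measurable borel (count_space UNIV)"
      using measurable_pullback[of i xs] by measurable
    moreover have "Base (shift (pullback M) b) =
        (if pullback M i xs then Base (Rel i xs z) else Base (Rel i xs (z + 1)))" for M
      by (simp add: Rel)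
    ultimately show ?thesis by simp
  qed simp_all
  then show ?case by (simp add: coding_aut_def)
next
  case (Node l n)
  have "(\<lambda>M. map (coding_aut M) l) \<in> measurable borel (count_space UNIV)"
    using Node.IH
  proof (induction l)
    case (Cons p l)
    show ?case
      unfolding list.map
    \<comment> \<open>The head takes countably many values, so it may be held constant while the
      tail varies.\<close>
    proof (rule measurable_compose_countable[where g = "\<lambda>M. coding_aut M p" and f = "\<lambda>q M. q # map (coding_aut M) l"])
      show "(\<lambda>M. coding_aut M p) \<in> measurable borel (count_space UNIV)" using Cons by simp
      show "(\<lambda>M. q # map (coding_aut M) l) \<in> measurable borel (count_space UNIV)" for q
        using Cons by (intro measurable_compose[where g = "\<lambda>l. q # l", OF Cons.IH]) auto
    qed
  qed simp
  then have "(\<lambda>M. Node (map (coding_aut M) l) (n + 1)) \<in> measurable borel (count_space UNIV)"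
    by (rule measurable_compose) simp
  then show ?case by (simp add: coding_aut_def)
qed

text \<open>Both \<open>host\<close> and \<open>T\<close> have the extension property, so back and
  forth yields an isomorphism \<open>G\<close>, along which the coding automorphisms and the
  commuting maps are transported.\<close>

lemma reduction_to_conjugacy:
  assumes "generic_tournament T"
  shows "\<exists>F. F \<in> measurable borel (Aut_space T) \<and>
     (\<forall>M N. structure_iso M N \<longleftrightarrow> conjugate_in_Aut T (F M) (F N))"
proof -
  have T: "tournament_on UNIV T" using assms by (simp add: generic_tournament_def)
  obtain G where G: "bij G" "\<And>x y. host x y \<longleftrightarrow> T (G x) (G y)"
    using back_and_forth[OF host_tournament host_extension T generic_tournament_extension[OF assms]]
    by blast
  have inv: "inv G (G x) = x" "G (inv G y) = y" for x y
    using G(1) by (simp_all add: bij_is_inj bij_is_surj surj_f_inv_f)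
  have G': "bij (inv G)" "\<And>x y. T x y \<longleftrightarrow> host (inv G x) (inv G y)"
    using G inv by (simp_all add: bij_imp_bij_inv)
  define F where "F M = G \<circ> coding_aut M \<circ> inv G" for M
  have F_Aut: "F M \<in> Aut T" for M
    unfolding F_def by (rule Aut_transport[where S = host, OF G coding_aut_in_Aut])
  have "structure_iso M N \<longleftrightarrow> conjugate_in_Aut T (F M) (F N)" for M N
  proof
    assume "structure_iso M N"
    then obtain \<delta> where \<delta>: "\<delta> \<in> Aut host" "\<delta> \<circ> coding_aut M = coding_aut N \<circ> \<delta>"
      using structure_iso_imp_commutes by blast
    have "(G \<circ> \<delta> \<circ> inv G) \<circ> F M = F N \<circ> (G \<circ> \<delta> \<circ> inv G)"
      using fun_cong[OF \<delta>(2)] by (simp add: fun_eq_iff F_def inv)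
    then show "conjugate_in_Aut T (F M) (F N)"
      using Aut_transport[where S = host, OF G \<delta>(1)] conjugate_iff_commutes[OF F_Aut F_Aut] by blast
  next
    assume "conjugate_in_Aut T (F M) (F N)"
    then obtain \<delta> where \<delta>: "\<delta> \<in> Aut T" "\<delta> \<circ> F M = F N \<circ> \<delta>"
      using conjugate_iff_commutes[OF F_Aut F_Aut] by blast
    have "inv G \<circ> \<delta> \<circ> G \<in> Aut host"
      using Aut_transport[OF G' \<delta>(1)] G(1) by (simp add: inv_inv_eq)
    moreover have "(inv G \<circ> \<delta> \<circ> G) \<circ> coding_aut M = coding_aut N \<circ> (inv G \<circ> \<delta> \<circ> G)"
    proof
      fix x
      have "\<delta> (G (coding_aut M x)) = G (coding_aut N (inv G (\<delta> (G x))))"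
        using fun_cong[OF \<delta>(2), of "G x"] by (simp add: F_def inv)
      then show "((inv G \<circ> \<delta> \<circ> G) \<circ> coding_aut M) x = (coding_aut N \<circ> (inv G \<circ> \<delta> \<circ> G)) x"
        by (simp add: inv)
    qed
    ultimately show "structure_iso M N" by (rule commutes_imp_structure_iso)
  qed
  moreover have "F \<in> measurable borel (Aut_space T)"
    unfolding Aut_space_def
  proof (rule measurable_restrict_space2)
    show "F \<in> borel_measurable borel"
    proof (rule measurable_coordinatewise_then_product)
      fix n
      show "(\<lambda>M. F M n) \<in> borel_measurable borel"
        unfolding F_def comp_def by (rule measurable_compose[OF measurable_coding_aut]) simp
    qed
  qed (use F_Aut in auto)
  ultimately show ?thesis by blast
qed

text \<open>All symbols are read as the same binary relation, so isomorphisms of these structures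
  are exactly isomorphisms of the relations.\<close>

definition tournament_structure :: "(nat \<Rightarrow> nat \<Rightarrow> bool) \<Rightarrow> nat \<Rightarrow> nat list \<Rightarrow> bool" where
  "tournament_structure R i xs \<longleftrightarrow> length xs = 2 \<and> R (xs ! 0) (xs ! 1)"

lemma rel_iso_iff_structure_iso:
  "rel_iso R S \<longleftrightarrow> structure_iso (tournament_structure R) (tournament_structure S)"
proof -
  have "(\<forall>x y. R x y \<longleftrightarrow> S (f x) (f y)) \<longleftrightarrow>
      (\<forall>i xs. tournament_structure R i xs \<longleftrightarrow> tournament_structure S i (map f xs))" (is "?A \<longleftrightarrow> ?B") for f
  proof
    show "?A \<Longrightarrow> ?B" by (auto simp: tournament_structure_def)
    assume B: ?B
    show ?A
    proof (intro allI)
      fix x y show "R x y \<longleftrightarrow> S (f x) (f y)"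
        using B[THEN spec, THEN spec, of 0 "[x, y]"] by (simp add: tournament_structure_def)
    qed
  qed
  then show ?thesis unfolding rel_iso_def structure_iso_def by simp
qed

lemma measurable_tournament_structure: "tournament_structure \<in> borel_measurable borel"
proof (intro borel_measurable_continuous_onI continuous_on_coordinatewise_then_product)
  fix i and xs :: "nat list"
  show "continuous_on UNIV (\<lambda>R. tournament_structure R i xs)"
    by (cases "length xs = 2")
      (simp_all add: tournament_structure_def continuous_on_product_then_coordinatewise[OF
          continuous_on_product_then_coordinatewise[OF continuous_on_id]])
qed

theorem theorem4p1:
  fixes T :: "nat \<Rightarrow> nat \<Rightarrow> bool"
  assumes "generic_tournament T"
  shows "borel_reducible tournament_space rel_iso (Aut_space T) (conjugate_in_Aut T)
       \<and> borel_complete (Aut_space T) (conjugate_in_Aut T)"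
proof -
  obtain F where F: "F \<in> measurable borel (Aut_space T)"
      "\<And>M N. structure_iso M N \<longleftrightarrow> conjugate_in_Aut T (F M) (F N)"
    using reduction_to_conjugacy[OF assms] by blast
  have "(\<lambda>R. F (tournament_structure R)) \<in> measurable tournament_space (Aut_space T)"
    unfolding tournament_space_def
    by (intro measurable_restrict_space1 measurable_compose[OF measurable_tournament_structure F(1)])
  then have "borel_reducible tournament_space rel_iso (Aut_space T) (conjugate_in_Aut T)"
    unfolding borel_reducible_def by (rule bexI[rotated]) (simp add: rel_iso_iff_structure_iso F(2))
  \<comment> \<open>As \<open>F\<close> reduces \<open>structure_iso\<close> on the whole type, its
    restrictions serve every language and every Borel class.\<close>
  moreover have "F \<in> measurable (restrict_space (structure_space L ar) C) (Aut_space T)" for L ar C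
    unfolding structure_space_def by (intro measurable_restrict_space1 F(1))
  then have "borel_complete (Aut_space T) (conjugate_in_Aut T)"
    unfolding borel_complete_def borel_reducible_def by (intro allI impI bexI[of _ F]) (simp_all add: F(2))
  ultimately show ?thesis ..
qed

end
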